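(* Assume that the noise $\xi_n=y_nx_n-\mathbb E[y_nx_n]$ has $\mathbb E\|\xi_n\|^2<\infty$ and satisfies $\mathbb E[\xi_n\otimes\xi_n]\preccurlyeq\tau^2\Sigma$ for some $\tau\in\mathbb R$. Fix $n\ge1$, let $\gamma>0$, put $\lambda=\frac1{\gamma(n+1)^2}$, assume $\gamma(\Sigma+\lambda I)\preccurlyeq I$, and let $\delta\in\big[1-\frac2{n+2},1\big]$. Let $\theta_0\in\mathcal H$, $\theta_{-1}=\theta_0$, and for $1\le k\le n$ $$\theta_k=\big[I-\gamma\Sigma-\gamma\lambda I\big]\big[\theta_{k-1}+\delta(\theta_{k-1}-\theta_{k-2})\big]+\gamma\,y_kx_k+\gamma\lambda\,\theta_0,\qquad \bar\theta_n=\frac1{n+1}\sum_{i=0}^n\theta_i .$$ Then $$\mathbb E f(\bar\theta_n)-f(\theta_* )\le\min_{r\in[0,1],\ b\in[0,1]}\bigg[74\,\frac{\big\|\Sigma^{r/2}(\theta_0-\theta_* )\big\|^2}{\gamma^{1-r}(n+1)^{2(1-r)}}+8\,\frac{\tau^2\gamma^b\operatorname{tr}(\Sigma^b)}{(n+1)^{1-2b}}\bigg].$$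
   Context: $\mathcal H$ is a Euclidean space of dimension $d\ge1$. The observations $(x_n,y_n)\in\mathcal H\times\mathbb R$, $n\ge1$, are i.i.d. with $\mathbb E\|x_n\|^2$ and $\mathbb E y_n^2$ finite. The objective is $f(\theta)=\frac12\mathbb E(\langle x_n,\theta\rangle-y_n)^2$. $\Sigma=\mathbb E[x_n\otimes x_n]$ is the covariance matrix, assumed invertible, and $\theta_*=\Sigma^{-1}\mathbb E[y_nx_n]$ is the global minimizer of $f$. $A\preccurlyeq B$ means that $B-A$ is positive semi-definite. The setting is finite horizon: $n$ is fixed in advance, $\lambda$ depends on $n$, and the parameters are constant along the iterations. $\theta_0$ is deterministic. *)

theory Defs
  imports "HOL-Probability.Probability"
begin

text \<open>Linear operators on a Euclidean space are represented as functions \<open>'h \<Rightarrow> 'h\<close>.\<close>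

definition outer_prod :: "'h::euclidean_space \<Rightarrow> 'h \<Rightarrow> 'h \<Rightarrow> 'h"
  where "outer_prod u v = (\<lambda>w. (v \<bullet> w) *\<^sub>R u)"

text \<open>The expectation of the random operator \<open>outer_prod X X\<close> is taken pointwise; in finite dimension
  this agrees with the entrywise expectation of its matrix.\<close>

definition second_moment :: "'a measure \<Rightarrow> ('a \<Rightarrow> 'h::euclidean_space) \<Rightarrow> 'h \<Rightarrow> 'h"
  where "second_moment M X = (\<lambda>w. \<integral>\<omega>. outer_prod (X \<omega>) (X \<omega>) w \<partial>M)"

definition pos_semidef :: "('h::euclidean_space \<Rightarrow> 'h) \<Rightarrow> bool"
  where "pos_semidef A \<longleftrightarrow>
    linear A \<and> (\<forall>u v. A u \<bullet> v = u \<bullet> A v) \<and> (\<forall>v. 0 \<le> v \<bullet> A v)"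

definition loewner_le :: "('h::euclidean_space \<Rightarrow> 'h) \<Rightarrow> ('h \<Rightarrow> 'h) \<Rightarrow> bool"  (infix \<open>\<preceq>\<^sub>L\<close> 50)
  where "A \<preceq>\<^sub>L B \<longleftrightarrow> pos_semidef (\<lambda>v. B v - A v)"

definition op_trace :: "('h::euclidean_space \<Rightarrow> 'h) \<Rightarrow> real"
  where "op_trace A = (\<Sum>e\<in>Basis. e \<bullet> A e)"

definition eigenspace :: "('h::euclidean_space \<Rightarrow> 'h) \<Rightarrow> real \<Rightarrow> 'h set"
  where "eigenspace A \<mu> = {v. A v = \<mu> *\<^sub>R v}"

definition eigenvalues :: "('h::euclidean_space \<Rightarrow> 'h) \<Rightarrow> real set"
  where "eigenvalues A = {\<mu>. \<exists>v\<in>eigenspace A \<mu>. v \<noteq> 0}"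

text \<open>Real power of a self-adjoint positive definite operator by its spectral decomposition: on a
  subspace, \<open>closest_point\<close> is the orthogonal projection. Because \<open>0 powr 0 = 0\<close>, the
  exponent \<open>0\<close> yields the identity only when the operator is invertible.\<close>

definition op_powr :: "('h::euclidean_space \<Rightarrow> 'h) \<Rightarrow> real \<Rightarrow> 'h \<Rightarrow> 'h"
  where "op_powr A s = (\<lambda>v. \<Sum>\<mu>\<in>eigenvalues A. (\<mu> powr s) *\<^sub>R closest_point (eigenspace A \<mu>) v)"

definition ls_risk :: "'a measure \<Rightarrow> ('a \<Rightarrow> 'h::euclidean_space) \<Rightarrow> ('a \<Rightarrow> real) \<Rightarrow> 'h \<Rightarrow> real"
  where "ls_risk M X Y \<theta> = 1/2 * (\<integral>\<omega>. (X \<omega> \<bullet> \<theta> - Y \<omega>)\<^sup>2 \<partial>M)"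

end

theory Submission
  imports Defs
begin

text \<open>In an eigendirection of \<open>\<Sigma>\<close> with eigenvalue \<open>s\<close> the recursion becomes scalar, with
  contraction factor \<open>a = 1 - \<gamma> s - 1/N\<^sup>2\<close> and \<open>N = n + 1\<close>. Let \<open>q\<close> solve the homogeneous recursion
  with \<open>q (-1) = q 0 = 1\<close>. Nesterov's energy \<open>(1 - a) (q k)\<^sup>2 + (q k - q (k-1))\<^sup>2\<close> is nonincreasing, hence
  \<open>\<bar>q k\<bar> \<le> 1\<close> and \<open>\<bar>q k - q (k-1)\<bar> \<le> sqrt (1 - a)\<close>. Both parts of the averaged error are explicit
  in \<open>q\<close>: the bias involves \<open>\<Sum>k\<le>n. q k\<close>, which telescopes after multiplication by \<open>1 - a\<close>, and the
  noise of step \<open>j\<close> enters with weight proportional to \<open>(1 - q (n + 1 - j)) / (1 - a)\<close>. As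
  \<open>1 - a\<close> is at least \<open>\<gamma> s\<close> and at least \<open>1/N\<^sup>2\<close>, interpolating between these two bounds gives the exponents
  \<open>r\<close> and \<open>b\<close>. Distinct noise vectors are uncorrelated, so the risks add up over steps and
  eigendirections.\<close>

section \<open>The scalar recursion\<close>

text \<open>Starts from the convention \<open>q (-1) = q 0 = 1\<close>, hence \<open>q 1 = a\<close>.\<close>

fun nesterov_factor :: "real \<Rightarrow> real \<Rightarrow> nat \<Rightarrow> real" where
  "nesterov_factor a \<delta> 0 = 1"
| "nesterov_factor a \<delta> (Suc 0) = a"
| "nesterov_factor a \<delta> (Suc (Suc k)) =
     a * ((1 + \<delta>) * nesterov_factor a \<delta> (Suc k) - \<delta> * nesterov_factor a \<delta> k)"

text \<open>Here \<open>c\<close> plays the role of \<open>1 - a\<close> and \<open>d\<close> that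
  of the last increment. In terms of the extrapolated point \<open>z = u + \<delta> * d\<close> the
  cross terms cancel, and the energy loss is an explicit sum of nonnegative terms once
  \<open>d\<^sup>2\<close> is lowered to \<open>(\<delta> * d)\<^sup>2\<close>.\<close>

lemma nesterov_step_energy:
  fixes c u d \<delta> :: real
  assumes "0 \<le> c" "c \<le> 1" "0 \<le> \<delta>" "\<delta> \<le> 1"
  defines "v \<equiv> (1 - c) * (u + \<delta> * d)"
  shows "c * v\<^sup>2 + (v - u)\<^sup>2 \<le> c * u\<^sup>2 + d\<^sup>2"
proof -
  define z where "z = u + \<delta> * d"
  have v: "v = (1 - c) * z" and u: "u = z - \<delta> * d"
    by (auto simp: v_def z_def)
  have "c * u\<^sup>2 + (\<delta> * d)\<^sup>2 - (c * v\<^sup>2 + (v - u)\<^sup>2) = c * (\<delta> * d)\<^sup>2 + c\<^sup>2 * (1 - c) * z\<^sup>2"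
    unfolding v u by (simp add: power2_eq_square algebra_simps)
  moreover have "0 \<le> c * (\<delta> * d)\<^sup>2 + c\<^sup>2 * (1 - c) * z\<^sup>2"
    using assms by simp
  moreover have "(\<delta> * d)\<^sup>2 \<le> d\<^sup>2"
    using assms by (simp add: abs_le_square_iff [symmetric] abs_mult mult_left_le_one_le)
  ultimately show ?thesis by linarith
qed

lemma nesterov_factor_energy:
  assumes "0 \<le> a" "a \<le> 1" "0 \<le> \<delta>" "\<delta> \<le> 1"
  shows "(1 - a) * (nesterov_factor a \<delta> (Suc k))\<^sup>2
    + (nesterov_factor a \<delta> (Suc k) - nesterov_factor a \<delta> k)\<^sup>2 \<le> 1 - a"
proof (induction k)
  case 0
  show ?case
    \<comment> \<open>The values \<open>u = 1\<close> and \<open>d = 0\<close> encode the convention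
      q (-1) = q 0 = 1; the initial energy is therefore \<open>1 - a\<close>.\<close>
    using nesterov_step_energy[of "1 - a" \<delta> 1 0] assms by simp
next
  case (Suc k)
  let ?q = "nesterov_factor a \<delta>"
  have "?q (Suc (Suc k)) = (1 - (1 - a)) * (?q (Suc k) + \<delta> * (?q (Suc k) - ?q k))"
    by (simp add: algebra_simps)
  then show ?case
    using nesterov_step_energy[of "1 - a" \<delta> "?q (Suc k)" "?q (Suc k) - ?q k"] assms Suc
    by (simp del: nesterov_factor.simps)
qed

lemma abs_nesterov_factor_le_1:
  assumes "0 \<le> a" "a < 1" "0 \<le> \<delta>" "\<delta> \<le> 1"
  shows "\<bar>nesterov_factor a \<delta> k\<bar> \<le> 1"
proof (cases k)
  case (Suc j)
  have "(1 - a) * (nesterov_factor a \<delta> k)\<^sup>2 \<le> (1 - a) * 1"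
    unfolding Suc mult_1_right
    using nesterov_factor_energy[of a \<delta> j] assms
      zero_le_power2[of "nesterov_factor a \<delta> (Suc j) - nesterov_factor a \<delta> j"]
    by linarith
  then show ?thesis
    using assms by (simp add: abs_square_le_1)
qed simp

lemma abs_nesterov_factor_diff_le:
  assumes "0 \<le> a" "a \<le> 1" "0 \<le> \<delta>" "\<delta> \<le> 1"
  shows "\<bar>nesterov_factor a \<delta> k - nesterov_factor a \<delta> (Suc k)\<bar> \<le> sqrt (1 - a)"
proof (rule real_le_rsqrt)
  have "0 \<le> (1 - a) * (nesterov_factor a \<delta> (Suc k))\<^sup>2"
    using assms by simp
  then show "\<bar>nesterov_factor a \<delta> k - nesterov_factor a \<delta> (Suc k)\<bar>\<^sup>2 \<le> 1 - a"
    using nesterov_factor_energy[of a \<delta> k] assms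
    unfolding power2_abs power2_commute[of "nesterov_factor a \<delta> k"] by linarith
qed

text \<open>Sum q (k + 1) = a (q k + \<delta> (q k - q (k - 1))) over k from 0 to n, with q (-1) =
  1: the increments telescope to q n - 1, and the two sums of q differ only in their end
  terms.\<close>

lemma sum_nesterov_factor:
  "(1 - a) * (\<Sum>k\<le>n. nesterov_factor a \<delta> k)
     = (1 - nesterov_factor a \<delta> (Suc n)) - a * \<delta> * (1 - nesterov_factor a \<delta> n)"
proof (induction n)
  case (Suc n)
  then show ?case by (simp add: algebra_simps)
qed simp

text \<open>Write s = sqrt (1 - a). The closed form of s^2 times the sum is one increment, at most s
  in absolute value, plus (1 - a \<delta>)(1 - q n). The condition on \<delta> makes 1 - a \<delta>
  at most 3 s, so the total is at most s + 3 s * 2 = 7 s.\<close>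

lemma abs_sum_nesterov_factor_le:
  assumes "0 \<le> a" "a < 1" "0 \<le> \<delta>" "\<delta> \<le> 1" "1 - \<delta> \<le> 2 * sqrt (1 - a)"
  shows "\<bar>\<Sum>k\<le>n. nesterov_factor a \<delta> k\<bar> \<le> 7 / sqrt (1 - a)"
proof -
  let ?q = "nesterov_factor a \<delta>"
  define s where "s = sqrt (1 - a)"
  have s: "0 < s" "s * s = 1 - a" "s \<le> 1"
    using assms by (auto simp: s_def real_sqrt_le_1_iff)
  have diff: "\<bar>?q n - ?q (Suc n)\<bar> \<le> s"
    unfolding s_def by (rule abs_nesterov_factor_diff_le) (use assms in auto)
  have "1 - a * \<delta> = s * s + a * (1 - \<delta>)"
    unfolding s(2) by (simp add: algebra_simps)
  also have "\<dots> \<le> s + 1 * (2 * s)"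
    using assms s(1,3)
    by (intro add_mono mult_mono mult_left_le) (auto simp: s_def[symmetric])
  finally have damp: "1 - a * \<delta> \<le> 3 * s" by simp
  have damp0: "0 \<le> 1 - a * \<delta>"
    using assms mult_mono[of a 1 \<delta> 1] by simp
  have "\<bar>(1 - a * \<delta>) * (1 - ?q n)\<bar> \<le> 3 * s * 2"
    unfolding abs_mult
    using damp damp0 s abs_nesterov_factor_le_1[of a \<delta> n] assms
    by (intro mult_mono) auto
  moreover have "s * s * (\<Sum>k\<le>n. ?q k) = (?q n - ?q (Suc n)) + (1 - a * \<delta>) * (1 - ?q n)"
    unfolding s sum_nesterov_factor by (simp add: algebra_simps)
  ultimately have "\<bar>s * s * (\<Sum>k\<le>n. ?q k)\<bar> \<le> s * 7"
    using diff by linarith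
  then have "s * (s * \<bar>\<Sum>k\<le>n. ?q k\<bar>) \<le> s * 7"
    using s(1) by (simp add: abs_mult mult.assoc)
  then have "s * \<bar>\<Sum>k\<le>n. ?q k\<bar> \<le> 7"
    using s(1) by simp
  then show ?thesis
    using s(1) unfolding s_def[symmetric] by (simp add: pos_le_divide_eq mult.commute)
qed

text \<open>The impulse response of the recursion (initial values \<open>0, 1\<close>) is \<open>(q m - q (m + 1)) / (1 - a)\<close>.
  The factor \<open>1 / (1 - a)\<close> is left out here.\<close>

definition nesterov_noise :: "real \<Rightarrow> real \<Rightarrow> (nat \<Rightarrow> real) \<Rightarrow> nat \<Rightarrow> real" where
  "nesterov_noise a \<delta> \<epsilon> k =
     (\<Sum>j=1..k. (nesterov_factor a \<delta> (k - j) - nesterov_factor a \<delta> (Suc k - j)) * \<epsilon> j)"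

text \<open>The weights \<open>?d\<close> are differences of solutions of the homogeneous recursion
  and so solve it too, which settles the noises up to \<open>k\<close>. The two newest noises have
  weights \<open>?d 1 = a * (1 + \<delta>) * ?d 0\<close> and \<open>?d 0 = 1 - a\<close>, which
  supply the remaining terms.\<close>

lemma nesterov_noise_Suc_Suc:
  "nesterov_noise a \<delta> \<epsilon> (Suc (Suc k)) =
     a * ((1 + \<delta>) * nesterov_noise a \<delta> \<epsilon> (Suc k) - \<delta> * nesterov_noise a \<delta> \<epsilon> k)
     + (1 - a) * \<epsilon> (Suc (Suc k))"
proof -
  let ?d = "\<lambda>m. nesterov_factor a \<delta> m - nesterov_factor a \<delta> (Suc m)"
  have noise: "nesterov_noise a \<delta> \<epsilon> m = (\<Sum>j=1..m. ?d (m - j) * \<epsilon> j)" for m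
    unfolding nesterov_noise_def by (intro sum.cong) (auto simp: Suc_diff_le)
  have d: "?d (Suc (Suc m)) = a * ((1 + \<delta>) * ?d (Suc m) - \<delta> * ?d m)" for m
    by (simp add: algebra_simps)
  have "(\<Sum>j=1..k. ?d (Suc (Suc k) - j) * \<epsilon> j)
      = (\<Sum>j=1..k. a * ((1 + \<delta>) * (?d (Suc k - j) * \<epsilon> j) - \<delta> * (?d (k - j) * \<epsilon> j)))"
  proof (intro sum.cong refl)
    fix j assume "j \<in> {1..k}"
    then have "Suc (Suc k) - j = Suc (Suc (k - j))" "Suc k - j = Suc (k - j)"
      by auto
    then show "?d (Suc (Suc k) - j) * \<epsilon> j
        = a * ((1 + \<delta>) * (?d (Suc k - j) * \<epsilon> j) - \<delta> * (?d (k - j) * \<epsilon> j))"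
      by (simp only: d) (simp add: algebra_simps)
  qed
  also have "\<dots> = a * ((1 + \<delta>) * (\<Sum>j=1..k. ?d (Suc k - j) * \<epsilon> j)
      - \<delta> * (\<Sum>j=1..k. ?d (k - j) * \<epsilon> j))"
    by (simp add: sum_distrib_left sum_subtractf right_diff_distrib del: nesterov_factor.simps)
  finally have "(\<Sum>j=1..k. ?d (Suc (Suc k) - j) * \<epsilon> j) = \<dots>" .
  then show ?thesis
    unfolding noise by (simp add: algebra_simps)
qed

text \<open>For fixed \<open>j\<close> the weights telescope over the steps from \<open>j\<close> to
  \<open>n\<close>, leaving q 0 - q (n + 1 - j) with q 0 = 1.\<close>

lemma sum_nesterov_noise:
  "(\<Sum>k\<le>n. nesterov_noise a \<delta> \<epsilon> k)
     = (\<Sum>j=1..n. (1 - nesterov_factor a \<delta> (Suc n - j)) * \<epsilon> j)"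
proof (induction n)
  case (Suc n)
  let ?q = "nesterov_factor a \<delta>"
  \<comment> \<open>On the right the sum of the induction hypothesis may run up to
    \<open>Suc n\<close>, since its extra term has weight 1 - q 0 = 0.\<close>
  have "(\<Sum>j=1..Suc n. (1 - ?q (Suc (Suc n) - j)) * \<epsilon> j)
      = (\<Sum>j=1..Suc n. (1 - ?q (Suc n - j)) * \<epsilon> j) + nesterov_noise a \<delta> \<epsilon> (Suc n)"
    unfolding nesterov_noise_def sum.distrib[symmetric]
    by (intro sum.cong refl) (simp add: algebra_simps)
  then show ?case
    using Suc by simp
qed (simp add: nesterov_noise_def)

text \<open>The equation for \<open>u 1\<close> is the general recursion under the convention \<open>u (-1) = u 0\<close>.\<close>

lemma nesterov_closed_form:
  fixes u \<epsilon> :: "nat \<Rightarrow> real"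
  assumes "a \<noteq> 1"
    and first: "1 \<le> n \<Longrightarrow> u 1 = a * u 0 + \<epsilon> 1 + g * u 0"
    and rec: "\<And>k. Suc (Suc k) \<le> n \<Longrightarrow> u (Suc (Suc k)) =
      a * ((1 + \<delta>) * u (Suc k) - \<delta> * u k) + \<epsilon> (Suc (Suc k)) + g * u 0"
    and "k \<le> n"
  defines "p \<equiv> g / (1 - a)"
  shows "u k = (p + (1 - p) * nesterov_factor a \<delta> k) * u 0 + nesterov_noise a \<delta> \<epsilon> k / (1 - a)"
  using \<open>k \<le> n\<close>
proof (induction k rule: induct_nat_012)
  case 0
  then show ?case by (simp add: nesterov_noise_def)
next
  case 1
  \<comment> \<open>Thus p = a p + g: the level \<open>p * u 0\<close> is stationary under the
    constant source \<open>g * u 0\<close>, and q governs only the deviation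
    \<open>(1 - p) * u 0\<close> from it.\<close>
  have g: "g = p * (1 - a)"
    using \<open>a \<noteq> 1\<close> by (simp add: p_def)
  have "nesterov_noise a \<delta> \<epsilon> 1 / (1 - a) = \<epsilon> 1"
    using \<open>a \<noteq> 1\<close> by (simp add: nesterov_noise_def)
  then show ?case
    using 1 first by (simp add: g algebra_simps)
next
  case (ge2 k)
  have g: "g = p * (1 - a)"
    using \<open>a \<noteq> 1\<close> by (simp add: p_def)
  have "u (Suc (Suc k)) =
      a * ((1 + \<delta>) * u (Suc k) - \<delta> * u k) + \<epsilon> (Suc (Suc k)) + g * u 0"
    using ge2 by (intro rec)
  moreover define V where "V m = nesterov_noise a \<delta> \<epsilon> m / (1 - a)" for m
  have noise: "nesterov_noise a \<delta> \<epsilon> m = (1 - a) * V m" for m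
    using \<open>a \<noteq> 1\<close> by (simp add: V_def)
  have "(1 - a) * V (Suc (Suc k)) =
      (1 - a) * (a * ((1 + \<delta>) * V (Suc k) - \<delta> * V k) + \<epsilon> (Suc (Suc k)))"
    using nesterov_noise_Suc_Suc[of a \<delta> \<epsilon> k] unfolding noise by (simp add: algebra_simps)
  then have "V (Suc (Suc k)) = a * ((1 + \<delta>) * V (Suc k) - \<delta> * V k) + \<epsilon> (Suc (Suc k))"
    using \<open>a \<noteq> 1\<close> by simp
  moreover have "u (Suc k) = (p + (1 - p) * nesterov_factor a \<delta> (Suc k)) * u 0 + V (Suc k)"
    "u k = (p + (1 - p) * nesterov_factor a \<delta> k) * u 0 + V k"
    using ge2 by (auto simp: V_def)
  ultimately show ?case
    unfolding V_def[symmetric] by (simp add: g algebra_simps)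
qed

section \<open>Bias and variance factors in one eigendirection\<close>

lemma powr_mult_powr_double:
  fixes h N s :: real
  assumes "0 < h" "0 < N"
  shows "h powr s * N powr (2 * s) = (h * N\<^sup>2) powr s"
proof -
  have "N powr (2 * s) = (N powr 2) powr s"
    by (simp only: powr_powr)
  then show ?thesis
    using assms by (simp add: powr_mult)
qed

text \<open>Here \<open>h\<close> stands for \<gamma> s and \<open>S\<close> for the sum of q. Put w
  = c N^2 = 1 + h N^2. Then p = 1/w is at most 1 / sqrt w, and S/N is at most 7 / sqrt w in absolute
  value, so the squared factor is at most (1 + 7)^2 / w. The remaining powers combine to (h N^2)^(1
  - r), which w \<ge> 1 dominates.\<close>

lemma bias_factor_bound:
  fixes h N S c r p :: real
  assumes "0 < h" "0 < N" "c = h + 1 / N\<^sup>2" "\<bar>S\<bar> \<le> 7 / sqrt c" "0 \<le> r" "r \<le> 1"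
    and p: "p = 1 / N\<^sup>2 / c"
  shows "h powr (1 - r) * (p + (1 - p) * (S / N))\<^sup>2 \<le> 64 / N powr (2 * (1 - r))"
proof -
  define w where "w = c * N\<^sup>2"
  have w: "w = 1 + h * N\<^sup>2"
    using assms by (simp add: w_def field_simps)
  then have w1: "1 \<le> w"
    using assms by simp
  have c0: "0 < c"
    using assms by (simp add: add_pos_pos)
  have p: "p = 1 / w"
    by (simp add: p w_def)
  have p01: "0 \<le> p" "p \<le> 1"
    using w1 by (auto simp: p)
  have sw: "sqrt w = sqrt c * N"
    using assms by (simp add: w_def real_sqrt_mult)
  have "p \<le> 1 / sqrt w"
    unfolding p using w1 real_le_lsqrt[of w w] by (intro divide_left_mono) (auto simp: power2_eq_square)
  moreover have "\<bar>S / N\<bar> \<le> 7 / sqrt w"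
    using assms c0 by (simp add: sw divide_simps)
  then have "(1 - p) * \<bar>S / N\<bar> \<le> 1 * (7 / sqrt w)"
    using p01 by (intro mult_mono) auto
  ultimately have "\<bar>p + (1 - p) * (S / N)\<bar> \<le> 8 / sqrt w"
    using p01 abs_triangle_ineq[of p "(1 - p) * (S / N)"] by (simp add: abs_mult)
  then have "\<bar>p + (1 - p) * (S / N)\<bar>\<^sup>2 \<le> (8 / sqrt w)\<^sup>2"
    by (intro power_mono) auto
  then have F: "(p + (1 - p) * (S / N))\<^sup>2 \<le> 64 / w"
    using w1 by (simp add: power_divide)
  have "h powr (1 - r) * N powr (2 * (1 - r)) = (h * N\<^sup>2) powr (1 - r)"
    using assms by (intro powr_mult_powr_double)
  also have "\<dots> \<le> w powr (1 - r)"
    using assms w by (intro powr_mono2) auto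
  also have "\<dots> \<le> w powr 1"
    using assms w1 by (intro powr_mono) auto
  finally have h: "h powr (1 - r) * N powr (2 * (1 - r)) \<le> w"
    using w1 by simp
  have "h powr (1 - r) * (p + (1 - p) * (S / N))\<^sup>2 * N powr (2 * (1 - r))
      = (h powr (1 - r) * N powr (2 * (1 - r))) * (p + (1 - p) * (S / N))\<^sup>2"
    by simp
  also have "\<dots> \<le> w * (64 / w)"
    using h F w1 by (intro mult_mono) auto
  finally show ?thesis
    using w1 assms by (simp add: pos_le_divide_eq)
qed

text \<open>Since c \<ge> h, the ratio h/c is at most 1, so its square is at most its b-th power.
  Since c \<ge> 1/N^2, the ratio is also at most h N^2.\<close>

lemma variance_factor_bound:
  fixes h N c b :: real
  assumes "0 < h" "0 < N" "c = h + 1 / N\<^sup>2" "0 \<le> b" "b \<le> 1"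
  shows "(h / c)\<^sup>2 \<le> h powr b * N powr (2 * b)"
proof -
  have c0: "0 < c"
    using assms by (simp add: add_pos_pos)
  have "c * N\<^sup>2 = h * N\<^sup>2 + 1"
    using assms by (simp add: field_simps)
  then have "1 / c \<le> N\<^sup>2"
    using assms c0 by (simp add: pos_divide_le_eq mult.commute)
  then have hc: "h / c \<le> h * N\<^sup>2"
    using assms mult_left_mono[of "1 / c" "N\<^sup>2" h] by simp
  have "(h / c)\<^sup>2 = (h / c) powr 2"
    using assms c0 by simp
  also have "\<dots> \<le> (h / c) powr b"
    using assms c0 by (intro powr_mono') auto
  also have "\<dots> \<le> (h * N\<^sup>2) powr b"
    using assms c0 hc by (intro powr_mono2) auto
  also have "\<dots> = h powr b * N powr (2 * b)"
    using assms by (intro powr_mult_powr_double[symmetric])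
  finally show ?thesis .
qed

lemma nesterov_sum:
  fixes u \<epsilon> :: "nat \<Rightarrow> real"
  assumes "a \<noteq> 1"
    and "1 \<le> n \<Longrightarrow> u 1 = a * u 0 + \<epsilon> 1 + g * u 0"
    and "\<And>k. Suc (Suc k) \<le> n \<Longrightarrow> u (Suc (Suc k)) =
      a * ((1 + \<delta>) * u (Suc k) - \<delta> * u k) + \<epsilon> (Suc (Suc k)) + g * u 0"
  defines "p \<equiv> g / (1 - a)"
  shows "(\<Sum>k\<le>n. u k) = ((real n + 1) * p + (1 - p) * (\<Sum>k\<le>n. nesterov_factor a \<delta> k)) * u 0
    + (\<Sum>j=1..n. (1 - nesterov_factor a \<delta> (Suc n - j)) * \<epsilon> j) / (1 - a)"
proof -
  have "(\<Sum>k\<le>n. u k) = (\<Sum>k\<le>n. (p + (1 - p) * nesterov_factor a \<delta> k) * u 0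
      + nesterov_noise a \<delta> \<epsilon> k / (1 - a))"
    unfolding p_def by (intro sum.cong refl nesterov_closed_form[OF assms(1-3)]) auto
  also have "\<dots> = (\<Sum>k\<le>n. p + (1 - p) * nesterov_factor a \<delta> k) * u 0
      + (\<Sum>k\<le>n. nesterov_noise a \<delta> \<epsilon> k) / (1 - a)"
    by (simp only: sum.distrib[of "\<lambda>k. _ k * u 0"] sum_distrib_right sum_divide_distrib)
  also have "(\<Sum>k\<le>n. p + (1 - p) * nesterov_factor a \<delta> k)
      = (real n + 1) * p + (1 - p) * (\<Sum>k\<le>n. nesterov_factor a \<delta> k)"
    by (simp add: sum.distrib sum_distrib_left)
  finally show ?thesis
    by (simp only: sum_nesterov_noise)
qed

text \<open>Split s = s^r s^(1 - r): the first factor goes into the norm with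
  \<open>\<Sigma>\<close> to the power r/2, the second is absorbed by the squared bias factor. This
  yields the constant 64/2 = 32, which is then relaxed to 74.\<close>

lemma bias_term_bound:
  fixes s \<gamma> N S c r p d :: real
  assumes "0 < s" "0 < \<gamma>" "0 < N" "c = \<gamma> * s + 1 / N\<^sup>2" "\<bar>S\<bar> \<le> 7 / sqrt c" "0 \<le> r" "r \<le> 1"
    and "p = 1 / N\<^sup>2 / c"
  shows "1/2 * (s * ((p + (1 - p) * (S / N)) * d)\<^sup>2)
    \<le> 74 * ((s powr (r / 2) * d)\<^sup>2 / (\<gamma> powr (1 - r) * N powr (2 * (1 - r))))"
proof -
  define F where "F = p + (1 - p) * (S / N)"
  have "(\<gamma> * s) powr (1 - r) * F\<^sup>2 \<le> 64 / N powr (2 * (1 - r))"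
    unfolding F_def using assms by (intro bias_factor_bound) auto
  then have F: "s powr (1 - r) * F\<^sup>2 \<le> 64 / (\<gamma> powr (1 - r) * N powr (2 * (1 - r)))"
    using assms by (simp add: powr_mult field_simps)
  have sr: "s powr r = (s powr (r / 2))\<^sup>2"
    using assms by (simp add: power2_eq_square flip: powr_add)
  have "s = s powr r * s powr (1 - r)"
    using assms by (simp flip: powr_add)
  then have "1/2 * (s * (F * d)\<^sup>2) = 1/2 * (s powr r * d\<^sup>2) * (s powr (1 - r) * F\<^sup>2)"
    by (simp add: power_mult_distrib)
  also have "\<dots> \<le> 1/2 * (s powr r * d\<^sup>2) * (64 / (\<gamma> powr (1 - r) * N powr (2 * (1 - r))))"
    by (intro mult_left_mono F) auto
  also have "\<dots> = 32 * ((s powr (r / 2) * d)\<^sup>2 / (\<gamma> powr (1 - r) * N powr (2 * (1 - r))))"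
    by (simp add: sr power_mult_distrib)
  also have "\<dots> \<le> 74 * ((s powr (r / 2) * d)\<^sup>2 / (\<gamma> powr (1 - r) * N powr (2 * (1 - r))))"
    by (intro mult_right_mono) auto
  finally show ?thesis
    by (simp add: F_def)
qed

text \<open>The left side is the contribution of \<open>N - 1\<close> noises of variance at most
  \<tau>^2 s, each with weight at most 2 \<gamma> / (c N). As (N - 1)/N^2 \<le> 1/N, the constant is
  4/2 = 2, relaxed to 8.\<close>

lemma variance_term_bound:
  fixes s \<gamma> N c b \<tau> :: real
  assumes "0 < s" "0 < \<gamma>" "1 \<le> N" "c = \<gamma> * s + 1 / N\<^sup>2" "0 \<le> b" "b \<le> 1"
  shows "1/2 * (s * ((N - 1) * ((2 * \<gamma> / (c * N))\<^sup>2 * (\<tau>\<^sup>2 * s))))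
    \<le> 8 * (\<tau>\<^sup>2 * \<gamma> powr b * s powr b / N powr (1 - 2 * b))"
proof -
  have c0: "0 < c"
    using assms by (simp add: add_pos_pos)
  have hc: "(\<gamma> * s / c)\<^sup>2 \<le> (\<gamma> * s) powr b * N powr (2 * b)"
    using assms by (intro variance_factor_bound) auto
  have "1/2 * (s * ((N - 1) * ((2 * \<gamma> / (c * N))\<^sup>2 * (\<tau>\<^sup>2 * s))))
      = 2 * \<tau>\<^sup>2 * ((N - 1) / N\<^sup>2 * (\<gamma> * s / c)\<^sup>2)"
    using c0 assms(3) by (simp add: power2_eq_square field_simps)
  also have "\<dots> \<le> 2 * \<tau>\<^sup>2 * (1 / N * ((\<gamma> * s) powr b * N powr (2 * b)))"
    using assms hc by (intro mult_left_mono mult_mono) (auto simp: power2_eq_square field_simps)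
  also have "\<dots> = 2 * (\<tau>\<^sup>2 * \<gamma> powr b * s powr b / N powr (1 - 2 * b))"
    using assms by (simp add: powr_mult powr_diff)
  also have "\<dots> \<le> 8 * (\<tau>\<^sup>2 * \<gamma> powr b * s powr b / N powr (1 - 2 * b))"
    by (intro mult_right_mono) auto
  finally show ?thesis .
qed

section \<open>Spectral decomposition\<close>

locale symmetric_operator =
  fixes A :: "'h::euclidean_space \<Rightarrow> 'h"
  assumes linear: "linear A" and symmetric: "A u \<bullet> v = u \<bullet> A v"
begin

text \<open>Let \<open>v\<close> maximize the Rayleigh quotient on the unit sphere of
  \<open>S\<close>. The form \<open>b\<close> is nonnegative on \<open>S\<close> and vanishes at
  \<open>v\<close>, so its gradient \<open>2 *\<^sub>R g\<close> at \<open>v\<close> must vanish;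
  otherwise a small step against \<open>g\<close> would make \<open>b\<close> negative.\<close>

lemma exists_eigenvector:
  assumes S: "subspace S" "S \<noteq> {0}" "\<And>v. v \<in> S \<Longrightarrow> A v \<in> S"
  obtains v where "v \<in> S" "norm v = 1" "A v = (v \<bullet> A v) *\<^sub>R v"
proof -
  define K where "K = S \<inter> sphere 0 1"
  obtain w where w: "w \<in> S" "w \<noteq> 0"
    using S(1,2) subspace_0 by blast
  then have "(1 / norm w) *\<^sub>R w \<in> K"
    using S(1) by (simp add: K_def subspace_scale)
  moreover have "compact K"
    unfolding K_def using S(1) by (intro closed_Int_compact closed_subspace compact_sphere)
  moreover have "continuous_on K (\<lambda>v. v \<bullet> A v)"
    using linear_continuous_on[of A K] linear
    by (intro continuous_intros) (simp add: linear_conv_bounded_linear)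
  ultimately obtain v where v: "v \<in> K" "\<And>w. w \<in> K \<Longrightarrow> w \<bullet> A w \<le> v \<bullet> A v"
    using continuous_attains_sup[of K "\<lambda>v. v \<bullet> A v"] by blast
  have vS: "v \<in> S" and v1: "norm v = 1" "v \<bullet> v = 1"
    using v(1) by (auto simp: K_def norm_eq_1)
  define m where "m = v \<bullet> A v"
  define b where "b w = m * (w \<bullet> w) - w \<bullet> A w" for w
  have b_nonneg: "0 \<le> b w" if "w \<in> S" for w
  proof (cases "w = 0")
    case False
    have "(1 / norm w) *\<^sub>R w \<in> K"
      using that False S(1) by (simp add: K_def subspace_scale)
    from v(2)[OF this] have "(w \<bullet> A w) / (norm w)\<^sup>2 \<le> m"
      by (simp add: m_def linear_scale[OF linear] power2_eq_square)
    then show ?thesis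
      using False by (simp add: b_def divide_le_eq power2_norm_eq_inner)
  qed (simp add: b_def)
  define g where "g = m *\<^sub>R v - A v"
  have gS: "g \<in> S"
    unfolding g_def using vS S by (intro subspace_diff subspace_scale) auto
  have vAg: "v \<bullet> A g = A v \<bullet> g"
    by (rule symmetric[symmetric])
  have expand: "b (v - s *\<^sub>R g) = s\<^sup>2 * b g - 2 * s * (g \<bullet> g)" for s
  proof -
    have "b (v - s *\<^sub>R g) = (m - v \<bullet> A v) + s\<^sup>2 * b g - 2 * s * (g \<bullet> (m *\<^sub>R v - A v))"
      by (simp add: b_def linear_diff[OF linear] linear_scale[OF linear] inner_diff
          inner_commute vAg v1 power2_eq_square algebra_simps)
    then show ?thesis
      by (simp add: g_def[symmetric] m_def[symmetric])
  qed
  \<comment> \<open>The summand 1 keeps the denominator positive even if \<open>b g = 0\<close>.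
    With this step size \<open>b (v - s *\<^sub>R g)\<close> equals
    \<open>- (s\<^sup>2 * (b g + 1)) - s\<^sup>2\<close>, and nonnegativity forces
    \<open>s = 0\<close>.\<close>
  define s where "s = (g \<bullet> g) / (b g + 1)"
  have pos: "0 < b g + 1"
    using b_nonneg[OF gS] by simp
  have "0 \<le> s\<^sup>2 * b g - 2 * s * (g \<bullet> g)"
    unfolding expand[symmetric] using vS gS S(1)
    by (intro b_nonneg subspace_diff subspace_scale)
  moreover have "s * (b g + 1) = g \<bullet> g"
    using pos by (simp add: s_def)
  then have "s\<^sup>2 * b g - 2 * s * (g \<bullet> g) = - (s\<^sup>2 * (b g + 1)) - s\<^sup>2"
    by (simp flip: \<open>s * (b g + 1) = g \<bullet> g\<close> add: power2_eq_square algebra_simps)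
  moreover have "0 \<le> s\<^sup>2 * (b g + 1)"
    using pos by simp
  ultimately have "s\<^sup>2 \<le> 0" by linarith
  then have "g = 0"
    using pos by (simp add: s_def)
  then show ?thesis
    using that[OF vS v1(1)] by (simp add: g_def m_def)
qed

text \<open>Induction on the dimension: split off one unit eigenvector. Its orthogonal complement
  within \<open>S\<close> is again invariant because \<open>A\<close> is symmetric.\<close>

lemma orthonormal_eigenbasis_subspace:
  assumes "subspace S" "\<And>v. v \<in> S \<Longrightarrow> A v \<in> S"
  shows "\<exists>E. finite E \<and> pairwise orthogonal E \<and> span E = S
    \<and> (\<forall>e\<in>E. norm e = 1 \<and> A e = (e \<bullet> A e) *\<^sub>R e)"
  using assms
proof (induction "dim S" arbitrary: S rule: less_induct)
  case less
  show ?case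
  proof (cases "S = {0}")
    case True
    then show ?thesis
      by (intro exI[of _ "{}"]) auto
  next
    case False
    then obtain v where v: "v \<in> S" "norm v = 1" "A v = (v \<bullet> A v) *\<^sub>R v"
      using exists_eigenvector less.prems by metis
    have vv: "v \<bullet> v = 1"
      using v(2) by (simp add: norm_eq_1)
    define T where "T = {w \<in> S. v \<bullet> w = 0}"
    have subT: "subspace T"
      using less.prems(1) by (auto simp: T_def subspace_def inner_add_right)
    have "T \<subset> S"
    proof
      show "T \<noteq> S"
        using v(1) vv by (metis (mono_tags, lifting) T_def mem_Collect_eq zero_neq_one)
    qed (auto simp: T_def)
    then have "dim T < dim S"
      using subT less.prems(1) by (intro dim_psubset) (simp add: span_eq_iff[THEN iffD2])
    moreover have "A w \<in> T" if "w \<in> T" for w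
    proof -
      have "v \<bullet> A w = (v \<bullet> A v) * (v \<bullet> w)"
        using symmetric[of v w] v(3) inner_scaleR_left[of "v \<bullet> A v" v w] by metis
      then show ?thesis
        using that less.prems(2) by (simp add: T_def)
    qed
    ultimately obtain E where E: "finite E" "pairwise orthogonal E" "span E = T"
        "\<And>e. e \<in> E \<Longrightarrow> norm e = 1 \<and> A e = (e \<bullet> A e) *\<^sub>R e"
      using less.hyps[OF _ subT] by metis
    have ET: "E \<subseteq> T"
      using E(3) span_superset by auto
    have "span (insert v E) = S"
    proof
      show "span (insert v E) \<subseteq> S"
        using ET v(1) less.prems(1) by (intro span_minimal) (auto simp: T_def)
      show "S \<subseteq> span (insert v E)"
      proof
        fix w assume "w \<in> S"
        then have "w - (v \<bullet> w) *\<^sub>R v \<in> span E"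
          unfolding E(3) using v(1) vv less.prems(1)
          by (simp add: T_def subspace_diff subspace_scale inner_diff_right)
        then show "w \<in> span (insert v E)"
          using span_breakdown_eq by blast
      qed
    qed
    moreover have "pairwise orthogonal (insert v E)"
      using ET E(2) unfolding pairwise_insert
      by (auto simp: T_def orthogonal_def inner_commute)
    ultimately show ?thesis
      using E v by (intro exI[of _ "insert v E"]) auto
  qed
qed

end

text \<open>Multiplicities show as repeated values of \<open>ev\<close>, which may fail to be
  injective on \<open>E\<close>, whereas \<open>op_powr\<close> sums over distinct
  eigenvalues.\<close>

locale orthonormal_eigenbasis =
  fixes A :: "'h::euclidean_space \<Rightarrow> 'h" and E :: "'h set" and ev :: "'h \<Rightarrow> real"
  assumes lin: "linear A"
    and finite_basis: "finite E"
    and orth: "pairwise orthogonal E"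
    and span_basis: "span E = UNIV"
    and unit: "e \<in> E \<Longrightarrow> norm e = 1"
    and eigen: "e \<in> E \<Longrightarrow> A e = ev e *\<^sub>R e"
begin

lemma inner_basis: "e \<in> E \<Longrightarrow> e' \<in> E \<Longrightarrow> e \<bullet> e' = (if e = e' then 1 else 0)"
  using orth unit by (auto simp: pairwise_def orthogonal_def norm_eq_1)

lemma expand: "(\<Sum>e\<in>E. (e \<bullet> v) *\<^sub>R e) = v"
  using orthonormal_basis_expand[OF orth unit _ finite_basis, of v] span_basis
  by (simp add: inner_commute)

lemma inner_sum_basis: "e \<in> E \<Longrightarrow> e \<bullet> (\<Sum>e'\<in>E. g e' *\<^sub>R e') = g e"
  by (simp add: inner_sum_right inner_basis finite_basis if_distrib cong: if_cong)

lemma inner_expand: "v \<bullet> w = (\<Sum>e\<in>E. (e \<bullet> v) * (e \<bullet> w))"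
proof -
  have "v \<bullet> w = (\<Sum>e\<in>E. (e \<bullet> v) *\<^sub>R e) \<bullet> w"
    by (simp only: expand)
  then show ?thesis
    by (simp add: inner_sum_left)
qed

lemma norm_expand: "(norm v)\<^sup>2 = (\<Sum>e\<in>E. (e \<bullet> v)\<^sup>2)"
  unfolding power2_norm_eq_inner inner_expand[of v v] by (simp add: power2_eq_square)

lemma basis_eqI: "(\<And>e. e \<in> E \<Longrightarrow> e \<bullet> v = e \<bullet> w) \<Longrightarrow> v = w"
  using expand[of v] expand[of w] by (metis (mono_tags, lifting) sum.cong)

lemma operator_expand: "A v = (\<Sum>e\<in>E. (ev e * (e \<bullet> v)) *\<^sub>R e)"
proof -
  have "A v = A (\<Sum>e\<in>E. (e \<bullet> v) *\<^sub>R e)"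
    by (simp only: expand)
  also have "\<dots> = (\<Sum>e\<in>E. (e \<bullet> v) *\<^sub>R A e)"
    by (simp add: linear_sum[OF lin] linear_scale[OF lin] o_def)
  also have "\<dots> = (\<Sum>e\<in>E. (ev e * (e \<bullet> v)) *\<^sub>R e)"
    by (intro sum.cong) (auto simp: eigen mult.commute)
  finally show ?thesis .
qed

lemma inner_operator: "e \<in> E \<Longrightarrow> e \<bullet> A v = ev e * (e \<bullet> v)"
  unfolding operator_expand[of v] by (rule inner_sum_basis)

lemma in_eigenspace_iff: "v \<in> eigenspace A \<mu> \<longleftrightarrow> (\<forall>e\<in>E. ev e = \<mu> \<or> e \<bullet> v = 0)"
proof -
  have "A v = \<mu> *\<^sub>R v \<longleftrightarrow> (\<forall>e\<in>E. ev e * (e \<bullet> v) = \<mu> * (e \<bullet> v))"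
    using basis_eqI[of "A v" "\<mu> *\<^sub>R v"] inner_operator[of _ v] by (metis inner_scaleR_right)
  then show ?thesis
    by (auto simp: eigenspace_def)
qed

lemma eigenvalues_eq: "eigenvalues A = ev ` E"
proof (intro equalityI subsetI)
  fix \<mu> assume "\<mu> \<in> eigenvalues A"
  then obtain v where v: "v \<in> eigenspace A \<mu>" "v \<noteq> 0"
    by (auto simp: eigenvalues_def)
  then obtain e where "e \<in> E" "e \<bullet> v \<noteq> 0"
    using basis_eqI[of v 0] by auto
  then show "\<mu> \<in> ev ` E"
    using v(1) by (auto simp: in_eigenspace_iff)
next
  fix \<mu> assume "\<mu> \<in> ev ` E"
  then obtain e where "e \<in> E" "\<mu> = ev e"
    by auto
  moreover have "e \<noteq> 0"
    using unit \<open>e \<in> E\<close> by fastforce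
  ultimately show "\<mu> \<in> eigenvalues A"
    unfolding eigenvalues_def eigenspace_def using eigen by blast
qed

lemma subspace_eigenspace: "subspace (eigenspace A \<mu>)"
  using lin by (auto simp: subspace_def eigenspace_def linear_0 linear_add linear_scale
      scaleR_add_right)

text \<open>Compare coordinates: those with eigenvalue \<open>\<mu>\<close> contribute nothing to
  the distance from \<open>v\<close> to \<open>?p\<close>, and the others contribute equally for
  every point of the eigenspace, whose coordinates vanish there.\<close>

lemma closest_point_eigenspace:
  "closest_point (eigenspace A \<mu>) v = (\<Sum>e\<in>E. (if ev e = \<mu> then e \<bullet> v else 0) *\<^sub>R e)"
  (is "_ = ?p")
proof (rule closest_point_unique[symmetric])
  have ep: "e \<bullet> ?p = (if ev e = \<mu> then e \<bullet> v else 0)" if "e \<in> E" for e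
    using that by (rule inner_sum_basis)
  show "convex (eigenspace A \<mu>)" "closed (eigenspace A \<mu>)"
    by (simp_all add: subspace_eigenspace subspace_imp_convex closed_subspace)
  show "?p \<in> eigenspace A \<mu>"
    using ep by (auto simp: in_eigenspace_iff)
  show "\<forall>z\<in>eigenspace A \<mu>. dist v ?p \<le> dist v z"
  proof
    fix z assume z: "z \<in> eigenspace A \<mu>"
    have "(norm (v - ?p))\<^sup>2 \<le> (norm (v - z))\<^sup>2"
      unfolding norm_expand
      using z by (intro sum_mono) (auto simp: inner_diff_right ep in_eigenspace_iff)
    then show "dist v ?p \<le> dist v z"
      by (simp add: dist_norm)
  qed
qed

text \<open>After exchanging the sums, each basis vector is met by exactly one eigenvalue, its
  own.\<close>

lemma op_powr_expand: "op_powr A s v = (\<Sum>e\<in>E. (ev e powr s * (e \<bullet> v)) *\<^sub>R e)"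
proof -
  have "op_powr A s v = (\<Sum>\<mu>\<in>ev ` E. \<Sum>e\<in>E. (if ev e = \<mu> then \<mu> powr s * (e \<bullet> v) else 0) *\<^sub>R e)"
    unfolding op_powr_def eigenvalues_eq closest_point_eigenspace scaleR_sum_right
    by (intro sum.cong refl) simp
  also have "\<dots> = (\<Sum>e\<in>E. \<Sum>\<mu>\<in>ev ` E. if ev e = \<mu> then (\<mu> powr s * (e \<bullet> v)) *\<^sub>R e else 0)"
    by (subst sum.swap) (intro sum.cong refl; simp)
  also have "\<dots> = (\<Sum>e\<in>E. (ev e powr s * (e \<bullet> v)) *\<^sub>R e)"
    by (intro sum.cong refl) (simp add: finite_basis)
  finally show ?thesis .
qed

lemma norm_op_powr: "(norm (op_powr A s v))\<^sup>2 = (\<Sum>e\<in>E. (ev e powr s * (e \<bullet> v))\<^sup>2)"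
  unfolding norm_expand op_powr_expand by (intro sum.cong refl) (simp add: inner_sum_basis)

text \<open>The trace is taken in the standard basis; exchanging the sums leaves the squared norm of
  each eigenvector, which is 1.\<close>

lemma op_trace_op_powr: "op_trace (op_powr A s) = (\<Sum>e\<in>E. ev e powr s)"
proof -
  have "op_trace (op_powr A s) = (\<Sum>i\<in>Basis. \<Sum>e\<in>E. ev e powr s * ((e \<bullet> i) * (e \<bullet> i)))"
    unfolding op_trace_def op_powr_expand inner_sum_right
    by (intro sum.cong refl) (simp add: inner_commute mult.assoc)
  also have "\<dots> = (\<Sum>e\<in>E. ev e powr s * (\<Sum>i\<in>Basis. (e \<bullet> i) * (e \<bullet> i)))"
    by (subst sum.swap) (simp add: sum_distrib_left)
  also have "\<dots> = (\<Sum>e\<in>E. ev e powr s)"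
    by (intro sum.cong refl) (simp add: euclidean_inner[symmetric] unit norm_eq_1[symmetric])
  finally show ?thesis .
qed

end

section \<open>Second moments and excess risk\<close>

lemma integrable_mult_of_squares:
  fixes f g :: "'a \<Rightarrow> real"
  assumes [measurable]: "f \<in> borel_measurable M" "g \<in> borel_measurable M"
    and "integrable M (\<lambda>\<omega>. (f \<omega>)\<^sup>2)" "integrable M (\<lambda>\<omega>. (g \<omega>)\<^sup>2)"
  shows "integrable M (\<lambda>\<omega>. f \<omega> * g \<omega>)"
proof (rule Bochner_Integration.integrable_bound)
  show "integrable M (\<lambda>\<omega>. (f \<omega>)\<^sup>2 + (g \<omega>)\<^sup>2)"
    using assms by simp
  show "AE \<omega> in M. norm (f \<omega> * g \<omega>) \<le> norm ((f \<omega>)\<^sup>2 + (g \<omega>)\<^sup>2)"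
  proof (intro AE_I2)
    fix \<omega>
    have "\<bar>f \<omega>\<bar> * \<bar>g \<omega>\<bar> * 2 \<le> (f \<omega>)\<^sup>2 + (g \<omega>)\<^sup>2"
      using sum_squares_bound[of "\<bar>f \<omega>\<bar>" "\<bar>g \<omega>\<bar>"] by (simp add: mult_ac)
    then show "norm (f \<omega> * g \<omega>) \<le> norm ((f \<omega>)\<^sup>2 + (g \<omega>)\<^sup>2)"
      using mult_nonneg_nonneg[OF abs_ge_zero[of "f \<omega>"] abs_ge_zero[of "g \<omega>"]]
      unfolding real_norm_def abs_mult by linarith
  qed
qed measurable

lemma integrable_scaleR_of_squares:
  fixes X :: "'a \<Rightarrow> 'h::euclidean_space" and f :: "'a \<Rightarrow> real"
  assumes [measurable]: "f \<in> borel_measurable M" "X \<in> borel_measurable M"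
    and "integrable M (\<lambda>\<omega>. (f \<omega>)\<^sup>2)" "integrable M (\<lambda>\<omega>. (norm (X \<omega>))\<^sup>2)"
  shows "integrable M (\<lambda>\<omega>. f \<omega> *\<^sub>R X \<omega>)"
  by (rule Bochner_Integration.integrable_bound
      [OF integrable_mult_of_squares[of f M "\<lambda>\<omega>. norm (X \<omega>)"]])
    (use assms in \<open>auto simp: abs_mult\<close>)

lemma integrable_inner_square:
  fixes X :: "'a \<Rightarrow> 'h::euclidean_space"
  assumes [measurable]: "X \<in> borel_measurable M"
    and "integrable M (\<lambda>\<omega>. (norm (X \<omega>))\<^sup>2)"
  shows "integrable M (\<lambda>\<omega>. (X \<omega> \<bullet> u)\<^sup>2)"
proof (rule Bochner_Integration.integrable_bound)
  show "integrable M (\<lambda>\<omega>. (norm (X \<omega>) * norm u)\<^sup>2)"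
    using assms by (simp add: power_mult_distrib)
  show "AE \<omega> in M. norm ((X \<omega> \<bullet> u)\<^sup>2) \<le> norm ((norm (X \<omega>) * norm u)\<^sup>2)"
    by (intro AE_I2) (simp add: abs_le_square_iff[symmetric] Cauchy_Schwarz_ineq2)
qed measurable

lemma inner_second_moment:
  fixes X :: "'a \<Rightarrow> 'h::euclidean_space"
  assumes "X \<in> borel_measurable M" "integrable M (\<lambda>\<omega>. (norm (X \<omega>))\<^sup>2)"
  shows "u \<bullet> second_moment M X v = (\<integral>\<omega>. (X \<omega> \<bullet> u) * (X \<omega> \<bullet> v) \<partial>M)"
proof -
  have "integrable M (\<lambda>\<omega>. (X \<omega> \<bullet> v) *\<^sub>R X \<omega>)"
    using assms by (intro integrable_scaleR_of_squares integrable_inner_square) auto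
  then have "u \<bullet> second_moment M X v = (\<integral>\<omega>. u \<bullet> ((X \<omega> \<bullet> v) *\<^sub>R X \<omega>) \<partial>M)"
    unfolding second_moment_def outer_prod_def by (rule integral_inner_right[symmetric])
  then show ?thesis
    by (simp add: inner_commute mult.commute)
qed

lemma symmetric_operator_second_moment:
  fixes X :: "'a \<Rightarrow> 'h::euclidean_space"
  assumes X: "X \<in> borel_measurable M" "integrable M (\<lambda>\<omega>. (norm (X \<omega>))\<^sup>2)"
  shows "symmetric_operator (second_moment M X)"
proof (rule symmetric_operator.intro)
  have prod: "integrable M (\<lambda>\<omega>. (X \<omega> \<bullet> u) * (X \<omega> \<bullet> v))" for u v
    using X by (intro integrable_mult_of_squares integrable_inner_square) auto
  show "second_moment M X u \<bullet> v = u \<bullet> second_moment M X v" for u v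
    unfolding inner_commute[of "second_moment M X u"] inner_second_moment[OF X]
    by (simp add: mult.commute)
  show "linear (second_moment M X)"
  proof (rule linearI)
    show "second_moment M X (u + v) = second_moment M X u + second_moment M X v" for u v
      by (rule vector_eq_ldot[THEN iffD1])
        (simp add: inner_add_right inner_second_moment[OF X] distrib_left prod)
    show "second_moment M X (r *\<^sub>R u) = r *\<^sub>R second_moment M X u" for r u
      by (rule vector_eq_ldot[THEN iffD1])
        (simp add: inner_second_moment[OF X] mult.left_commute)
  qed
qed

text \<open>The risk is quadratic, and the normal equation at \<open>t\<close> cancels the linear
  term of its expansion around \<open>t\<close>.\<close>

lemma ls_risk_excess:
  fixes X :: "'a \<Rightarrow> 'h::euclidean_space" and Y :: "'a \<Rightarrow> real"
  assumes X: "X \<in> borel_measurable M" "integrable M (\<lambda>\<omega>. (norm (X \<omega>))\<^sup>2)"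
    and Y: "Y \<in> borel_measurable M" "integrable M (\<lambda>\<omega>. (Y \<omega>)\<^sup>2)"
    and normal_eq: "second_moment M X t = (\<integral>\<omega>. Y \<omega> *\<^sub>R X \<omega> \<partial>M)"
  shows "ls_risk M X Y v - ls_risk M X Y t = 1/2 * ((v - t) \<bullet> second_moment M X (v - t))"
proof -
  define d where "d = v - t"
  have XX: "integrable M (\<lambda>\<omega>. (X \<omega> \<bullet> u) * (X \<omega> \<bullet> w))" for u w
    using X by (intro integrable_mult_of_squares integrable_inner_square) auto
  have XY: "integrable M (\<lambda>\<omega>. (X \<omega> \<bullet> u) * Y \<omega>)" for u
    using X Y by (intro integrable_mult_of_squares integrable_inner_square) auto
  have YX: "integrable M (\<lambda>\<omega>. Y \<omega> *\<^sub>R X \<omega>)"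
    using X Y by (intro integrable_scaleR_of_squares) auto
  have sq: "(\<integral>\<omega>. (X \<omega> \<bullet> u - Y \<omega>)\<^sup>2 \<partial>M) = (\<integral>\<omega>. (X \<omega> \<bullet> u) * (X \<omega> \<bullet> u) \<partial>M)
      - 2 * (\<integral>\<omega>. (X \<omega> \<bullet> u) * Y \<omega> \<partial>M) + (\<integral>\<omega>. (Y \<omega>)\<^sup>2 \<partial>M)" for u
  proof -
    have "(X \<omega> \<bullet> u - Y \<omega>)\<^sup>2 = (X \<omega> \<bullet> u) * (X \<omega> \<bullet> u) - 2 * ((X \<omega> \<bullet> u) * Y \<omega>) + (Y \<omega>)\<^sup>2" for \<omega>
      by (simp add: power2_eq_square algebra_simps)
    then show ?thesis
      using XX XY Y by simp
  qed
  have cross: "(\<integral>\<omega>. (X \<omega> \<bullet> u) * Y \<omega> \<partial>M) = u \<bullet> second_moment M X t" for u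
  proof -
    have "u \<bullet> second_moment M X t = (\<integral>\<omega>. u \<bullet> (Y \<omega> *\<^sub>R X \<omega>) \<partial>M)"
      unfolding normal_eq by (rule integral_inner_right[OF YX, symmetric])
    then show ?thesis
      by (simp add: inner_commute mult.commute)
  qed
  interpret symmetric_operator "second_moment M X"
    by (rule symmetric_operator_second_moment[OF X])
  have v: "v = t + d"
    by (simp add: d_def)
  show ?thesis
    unfolding ls_risk_def sq cross inner_second_moment[OF X, symmetric] d_def[symmetric]
    unfolding v using symmetric[of d t]
    by (simp add: linear_add[OF linear] inner_add_left inner_add_right inner_commute field_simps)
qed

text \<open>Bias-variance split with deterministic part \<open>m\<close>: centering removes the
  terms linear in the noise, uncorrelatedness the off-diagonal ones.\<close>

lemma (in prob_space) expectation_square_uncorrelated: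
  fixes Z :: "'i \<Rightarrow> 'a \<Rightarrow> real"
  assumes J: "finite J"
    and Z: "\<And>j. j \<in> J \<Longrightarrow> Z j \<in> borel_measurable M"
      "\<And>j. j \<in> J \<Longrightarrow> integrable M (\<lambda>\<omega>. (Z j \<omega>)\<^sup>2)"
    and centered: "\<And>j. j \<in> J \<Longrightarrow> expectation (Z j) = 0"
    and uncorrelated: "\<And>i j. i \<in> J \<Longrightarrow> j \<in> J \<Longrightarrow> i \<noteq> j \<Longrightarrow> expectation (\<lambda>\<omega>. Z i \<omega> * Z j \<omega>) = 0"
  shows "integrable M (\<lambda>\<omega>. (m + (\<Sum>j\<in>J. g j * Z j \<omega>))\<^sup>2)"
    and "expectation (\<lambda>\<omega>. (m + (\<Sum>j\<in>J. g j * Z j \<omega>))\<^sup>2)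
      = m\<^sup>2 + (\<Sum>j\<in>J. (g j)\<^sup>2 * expectation (\<lambda>\<omega>. (Z j \<omega>)\<^sup>2))"
proof -
  have int: "integrable M (Z j)" if "j \<in> J" for j
    by (rule square_integrable_imp_integrable[OF Z[OF that]])
  have prod: "integrable M (\<lambda>\<omega>. Z i \<omega> * Z j \<omega>)" if "i \<in> J" "j \<in> J" for i j
    by (rule integrable_mult_of_squares[OF Z(1)[OF that(1)] Z(1)[OF that(2)]
          Z(2)[OF that(1)] Z(2)[OF that(2)]])
  have square_sum: "(m + s)\<^sup>2 = m\<^sup>2 + 2 * m * s + s * s" for s
    by (simp add: power2_eq_square algebra_simps)
  have eq: "(m + (\<Sum>j\<in>J. g j * Z j \<omega>))\<^sup>2 = m\<^sup>2 + (\<Sum>j\<in>J. (2 * m * g j) * Z j \<omega>)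
      + (\<Sum>i\<in>J. \<Sum>j\<in>J. (g i * g j) * (Z i \<omega> * Z j \<omega>))" for \<omega>
  proof -
    have "(m + (\<Sum>j\<in>J. g j * Z j \<omega>))\<^sup>2 = m\<^sup>2 + 2 * m * (\<Sum>j\<in>J. g j * Z j \<omega>)
        + (\<Sum>j\<in>J. g j * Z j \<omega>) * (\<Sum>j\<in>J. g j * Z j \<omega>)"
      by (rule square_sum)
    also have "(\<Sum>j\<in>J. g j * Z j \<omega>) * (\<Sum>j\<in>J. g j * Z j \<omega>)
        = (\<Sum>i\<in>J. \<Sum>j\<in>J. (g i * g j) * (Z i \<omega> * Z j \<omega>))"
      unfolding sum_product by (simp only: mult_ac)
    finally show ?thesis
      by (simp add: sum_distrib_left mult.assoc)
  qed
  show "integrable M (\<lambda>\<omega>. (m + (\<Sum>j\<in>J. g j * Z j \<omega>))\<^sup>2)"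
    unfolding eq using int prod by auto
  have "expectation (\<lambda>\<omega>. (m + (\<Sum>j\<in>J. g j * Z j \<omega>))\<^sup>2)
      = m\<^sup>2 + (\<Sum>j\<in>J. (2 * m * g j) * expectation (Z j))
      + (\<Sum>i\<in>J. \<Sum>j\<in>J. (g i * g j) * expectation (\<lambda>\<omega>. Z i \<omega> * Z j \<omega>))"
    unfolding eq using int prod by (simp add: prob_space)
  also have "\<dots> = m\<^sup>2
      + (\<Sum>i\<in>J. \<Sum>j\<in>J. if j = i then (g i)\<^sup>2 * expectation (\<lambda>\<omega>. (Z i \<omega>)\<^sup>2) else 0)"
    using centered uncorrelated
    by (auto intro!: sum.cong simp: power2_eq_square)
  also have "\<dots> = m\<^sup>2 + (\<Sum>j\<in>J. (g j)\<^sup>2 * expectation (\<lambda>\<omega>. (Z j \<omega>)\<^sup>2))"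
    using J by simp
  finally show "expectation (\<lambda>\<omega>. (m + (\<Sum>j\<in>J. g j * Z j \<omega>))\<^sup>2) = \<dots>" .
qed

lemma (in prob_space) expectation_mult_indep_vars:
  fixes Z :: "'i \<Rightarrow> 'a \<Rightarrow> real"
  assumes "indep_vars (\<lambda>_. borel) Z I" "i \<in> I" "j \<in> I" "i \<noteq> j"
    and "\<And>k. k \<in> I \<Longrightarrow> integrable M (Z k)"
  shows "expectation (\<lambda>\<omega>. Z i \<omega> * Z j \<omega>) = expectation (Z i) * expectation (Z j)"
proof -
  have "indep_vars (\<lambda>_. borel) Z {i, j}"
    using assms by (intro indep_vars_subset[OF assms(1)]) auto
  then have "expectation (\<lambda>\<omega>. \<Prod>k\<in>{i, j}. Z k \<omega>) = (\<Prod>k\<in>{i, j}. expectation (Z k))"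
    using assms by (intro indep_vars_lebesgue_integral) auto
  then show ?thesis
    using \<open>i \<noteq> j\<close> by simp
qed

text \<open>The risk bound is a function of r plus a function of b, so its minimum over the square
  is attained by minimizing each over a compact interval.\<close>

lemma continuous_minimum_separable:
  fixes F G :: "real \<Rightarrow> real"
  assumes "continuous_on {0..1} F" "continuous_on {0..1} G"
  obtains r b where "r \<in> {0..1}" "b \<in> {0..1}"
    "\<And>r' b'. r' \<in> {0..1} \<Longrightarrow> b' \<in> {0..1} \<Longrightarrow> F r + G b \<le> F r' + G b'"
proof -
  obtain r where "r \<in> {0..1}" "\<forall>r'\<in>{0..1}. F r \<le> F r'"
    using continuous_attains_inf[of "{0..1::real}" F] assms by auto
  moreover obtain b where "b \<in> {0..1}" "\<forall>b'\<in>{0..1}. G b \<le> G b'"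
    using continuous_attains_inf[of "{0..1::real}" G] assms by auto
  ultimately show ?thesis
    using that[of r b] by (simp add: add_mono)
qed

text \<open>The minimum over r and b is expressed as an attained one, by a minimizing pair. Iterates
  are indexed by integers to give \<open>\<theta> (-1)\<close> a place. As the observations are
  identically distributed, the first one defines \<open>f\<close> and
  \<open>\<Sigma>\<close>.\<close>

theorem corollary2:
  fixes M :: "'a measure"
    and x :: "nat \<Rightarrow> 'a \<Rightarrow> 'h::euclidean_space" and y :: "nat \<Rightarrow> 'a \<Rightarrow> real"
    and \<xi> :: "nat \<Rightarrow> 'a \<Rightarrow> 'h"
    and \<Sigma> :: "'h \<Rightarrow> 'h" and f :: "'h \<Rightarrow> real" and \<theta>star \<theta>0 :: 'h
    and \<theta> :: "int \<Rightarrow> 'a \<Rightarrow> 'h" and \<theta>bar :: "'a \<Rightarrow> 'h"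
    and \<tau> \<gamma> lam \<delta> :: real and n :: nat and B :: "real \<Rightarrow> real \<Rightarrow> real"
  assumes "prob_space M"
    and indep: "prob_space.indep_vars M (\<lambda>_. borel) (\<lambda>k \<omega>. (x k \<omega>, y k \<omega>)) {1..}"
    and ident: "\<And>k. k \<ge> 1 \<Longrightarrow>
      distr M borel (\<lambda>\<omega>. (x k \<omega>, y k \<omega>)) = distr M borel (\<lambda>\<omega>. (x 1 \<omega>, y 1 \<omega>))"
    and x_moment: "\<And>k. k \<ge> 1 \<Longrightarrow> integrable M (\<lambda>\<omega>. (norm (x k \<omega>))\<^sup>2)"
    and y_moment: "\<And>k. k \<ge> 1 \<Longrightarrow> integrable M (\<lambda>\<omega>. (y k \<omega>)\<^sup>2)"
    and f: "f = ls_risk M (x 1) (y 1)"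
    and \<Sigma>: "\<Sigma> = second_moment M (x 1)"
    and \<Sigma>_invertible: "bij \<Sigma>"
    and \<theta>star: "\<theta>star = inv \<Sigma> (\<integral>\<omega>. y 1 \<omega> *\<^sub>R x 1 \<omega> \<partial>M)"
    and \<xi>: "\<And>k \<omega>. k \<ge> 1 \<Longrightarrow> \<xi> k \<omega> = y k \<omega> *\<^sub>R x k \<omega> - (\<integral>\<omega>'. y k \<omega>' *\<^sub>R x k \<omega>' \<partial>M)"
    and \<xi>_moment: "\<And>k. k \<ge> 1 \<Longrightarrow> integrable M (\<lambda>\<omega>. (norm (\<xi> k \<omega>))\<^sup>2)"
    and \<xi>_cov: "\<And>k. k \<ge> 1 \<Longrightarrow> second_moment M (\<xi> k) \<preceq>\<^sub>L (\<lambda>v. \<tau>\<^sup>2 *\<^sub>R \<Sigma> v)"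
    and n: "n \<ge> 1"
    and \<gamma>: "\<gamma> > 0"
    and lam: "lam = 1 / (\<gamma> * (real n + 1)\<^sup>2)"
    and step: "(\<lambda>v. \<gamma> *\<^sub>R (\<Sigma> v + lam *\<^sub>R v)) \<preceq>\<^sub>L (\<lambda>v. v)"
    and \<delta>: "\<delta> \<in> {1 - 2 / (real n + 2)..1}"
    and \<theta>_0: "\<And>\<omega>. \<omega> \<in> space M \<Longrightarrow> \<theta> 0 \<omega> = \<theta>0"
    and \<theta>_minus_1: "\<And>\<omega>. \<omega> \<in> space M \<Longrightarrow> \<theta> (-1) \<omega> = \<theta>0"
    and \<theta>_rec: "\<And>k z \<omega>. \<omega> \<in> space M \<Longrightarrow> 1 \<le> k \<Longrightarrow> k \<le> n \<Longrightarrow>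
      z = \<theta> (int k - 1) \<omega> + \<delta> *\<^sub>R (\<theta> (int k - 1) \<omega> - \<theta> (int k - 2) \<omega>) \<Longrightarrow>
      \<theta> (int k) \<omega> = (z - \<gamma> *\<^sub>R \<Sigma> z - (\<gamma> * lam) *\<^sub>R z)
        + (\<gamma> * y k \<omega>) *\<^sub>R x k \<omega> + (\<gamma> * lam) *\<^sub>R \<theta>0"
    and \<theta>bar: "\<And>\<omega>. \<omega> \<in> space M \<Longrightarrow> \<theta>bar \<omega> = (1 / (real n + 1)) *\<^sub>R (\<Sum>i=0..int n. \<theta> i \<omega>)"
    and B: "\<And>r b. B r b =
      74 * ((norm (op_powr \<Sigma> (r / 2) (\<theta>0 - \<theta>star)))\<^sup>2
              / (\<gamma> powr (1 - r) * (real n + 1) powr (2 * (1 - r))))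
      + 8 * (\<tau>\<^sup>2 * \<gamma> powr b * op_trace (op_powr \<Sigma> b) / (real n + 1) powr (1 - 2 * b))"
  shows "\<exists>r\<in>{0..1}. \<exists>b\<in>{0..1}. (\<forall>r'\<in>{0..1}. \<forall>b'\<in>{0..1}. B r b \<le> B r' b')
           \<and> (\<integral>\<omega>. f (\<theta>bar \<omega>) \<partial>M) - f \<theta>star \<le> B r b"
proof -
  interpret prob_space M by fact

  \<comment> \<open>Regularity of the observations and the mean of the noise\<close>
  have xy: "random_variable borel (\<lambda>\<omega>. (x k \<omega>, y k \<omega>))" if "k \<ge> 1" for k
    using indep that unfolding indep_vars_def2 by auto
  have x_meas: "random_variable borel (x k)" if "k \<ge> 1" for k
    using measurable_compose[OF xy[OF that], of fst borel] by (simp add: borel_measurable_continuous_onI continuous_on_fst)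
  have y_meas: "random_variable borel (y k)" if "k \<ge> 1" for k
    using measurable_compose[OF xy[OF that], of snd borel] by (simp add: borel_measurable_continuous_onI continuous_on_snd)
  have yx_meas: "(\<lambda>p. snd p *\<^sub>R fst p) \<in> borel_measurable (borel :: ('h \<times> real) measure)"
    by (intro borel_measurable_continuous_onI continuous_intros)
  have yx_int: "integrable M (\<lambda>\<omega>. y k \<omega> *\<^sub>R x k \<omega>)" if "k \<ge> 1" for k
    by (rule integrable_scaleR_of_squares[OF y_meas[OF that] x_meas[OF that]
          y_moment[OF that] x_moment[OF that]])
  have normal_equation: "\<Sigma> \<theta>star = (\<integral>\<omega>. y 1 \<omega> *\<^sub>R x 1 \<omega> \<partial>M)"
    unfolding \<theta>star using \<Sigma>_invertible by (simp add: bij_is_surj surj_f_inv_f)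
  \<comment> \<open>Equality of the laws of the pairs carries the normal equation from the first
    observation to all of them.\<close>
  have mean: "(\<integral>\<omega>. y k \<omega> *\<^sub>R x k \<omega> \<partial>M) = \<Sigma> \<theta>star" if "k \<ge> 1" for k
  proof -
    have "(\<integral>\<omega>. y k \<omega> *\<^sub>R x k \<omega> \<partial>M)
        = (\<integral>p. snd p *\<^sub>R fst p \<partial>distr M borel (\<lambda>\<omega>. (x k \<omega>, y k \<omega>)))"
      by (subst integral_distr[OF xy[OF that] yx_meas]) simp
    also have "\<dots> = (\<integral>\<omega>. y 1 \<omega> *\<^sub>R x 1 \<omega> \<partial>M)"
      unfolding ident[OF that] by (subst integral_distr[OF xy yx_meas]) simp_all
    finally show ?thesis
      by (simp add: normal_equation)
  qed
  have \<xi>_eq: "\<xi> k \<omega> = y k \<omega> *\<^sub>R x k \<omega> - \<Sigma> \<theta>star" if "k \<ge> 1" for k \<omega>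
    using \<xi>[OF that] mean[OF that] by simp
  have \<xi>_fun: "\<xi> k = (\<lambda>\<omega>. y k \<omega> *\<^sub>R x k \<omega> - \<Sigma> \<theta>star)" if "k \<ge> 1" for k
    using \<xi>_eq[OF that] by auto
  have \<xi>_int: "integrable M (\<xi> k)" if "k \<ge> 1" for k
    unfolding \<xi>_fun[OF that] using yx_int[OF that] by simp
  have \<xi>_meas: "random_variable borel (\<xi> k)" if "k \<ge> 1" for k
    using \<xi>_int[OF that] by auto

  \<comment> \<open>An eigenbasis of \<open>\<Sigma>\<close> with positive eigenvalues\<close>
  interpret S: symmetric_operator \<Sigma>
    unfolding \<Sigma> by (intro symmetric_operator_second_moment x_meas x_moment) simp_all
  obtain E where E: "finite E" "pairwise orthogonal E" "span E = UNIV"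
      "\<And>e. e \<in> E \<Longrightarrow> norm e = 1 \<and> \<Sigma> e = (e \<bullet> \<Sigma> e) *\<^sub>R e"
    using S.orthonormal_eigenbasis_subspace[of UNIV] by auto
  define s where "s e = e \<bullet> \<Sigma> e" for e
  interpret D: orthonormal_eigenbasis \<Sigma> E s
    using E S.linear by (intro orthonormal_eigenbasis.intro) (auto simp: s_def)
  have s_pos: "0 < s e" if "e \<in> E" for e
  proof -
    have "0 \<le> s e"
      unfolding s_def \<Sigma> by (subst inner_second_moment) (auto intro: x_meas x_moment)
    moreover have "s e \<noteq> 0"
    proof
      assume "s e = 0"
      then have "\<Sigma> e = \<Sigma> 0"
        using D.eigen[OF that] by (simp add: linear_0[OF S.linear])
      then show False
        using \<Sigma>_invertible D.unit[OF that] by (metis bij_is_inj injD norm_zero zero_neq_one)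
    qed
    ultimately show ?thesis by simp
  qed

  \<comment> \<open>Parameters of the scalar recursions\<close>
  define N where "N = real n + 1"
  have N: "1 \<le> N" "0 < N"
    by (auto simp: N_def)
  have \<gamma>lam: "\<gamma> * lam = 1 / N\<^sup>2"
    using \<gamma> by (simp add: lam N_def)
  define a where "a e = 1 - \<gamma> * s e - 1 / N\<^sup>2" for e
  have c: "1 - a e = \<gamma> * s e + 1 / N\<^sup>2" for e
    by (simp add: a_def)
  have a: "0 \<le> a e" "a e < 1" if "e \<in> E" for e
  proof -
    have "0 \<le> e \<bullet> (e - \<gamma> *\<^sub>R (\<Sigma> e + lam *\<^sub>R e))"
      using step unfolding loewner_le_def pos_semidef_def by blast
    then have "0 \<le> 1 - \<gamma> * (s e + lam)"
      using D.inner_basis[OF that that]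
      by (simp add: inner_diff_right inner_add_right s_def)
    then show "0 \<le> a e"
      using \<gamma>lam by (simp add: a_def algebra_simps)
    have "0 < \<gamma> * s e" "0 < 1 / N\<^sup>2"
      using s_pos[OF that] \<gamma> N by auto
    then show "a e < 1"
      unfolding a_def by linarith
  qed
  have \<delta>_le: "1 - \<delta> \<le> 2 / (real n + 2)"
    using \<delta> by simp
  also have "\<dots> \<le> 1"
    by simp
  finally have \<delta>01: "0 \<le> \<delta>" "\<delta> \<le> 1"
    using \<delta> by auto
  \<comment> \<open>The regularization gives 1 - a \<ge> 1/N^2, so the lower end of the range of
    \<delta> keeps 1 - \<delta> of order sqrt (1 - a).\<close>
  have damping: "1 - \<delta> \<le> 2 * sqrt (1 - a e)" if "e \<in> E" for e
  proof -
    have "1 / N \<le> sqrt (1 - a e)"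
      using s_pos[OF that] \<gamma> by (intro real_le_rsqrt) (simp add: c power_divide)
    moreover have "2 / (real n + 2) \<le> 2 / N"
      by (simp add: N_def divide_simps)
    ultimately show ?thesis
      using \<delta>_le by simp
  qed

  \<comment> \<open>Coordinates of the averaged error\<close>
  let ?q = "\<lambda>e. nesterov_factor (a e) \<delta>"
  define Q where "Q e = (\<Sum>k\<le>n. ?q e k)" for e
  define p where "p e = 1 / N\<^sup>2 / (1 - a e)" for e
  \<comment> \<open>The deterministic part \<open>m e\<close> and the noise weights
    \<open>g e j\<close> are those of \<open>nesterov_sum\<close> with source coefficient 1/N^2 and
    noise scaled by \<gamma>, divided by N.\<close>
  define m where "m e = (p e + (1 - p e) * (Q e / N)) * (e \<bullet> (\<theta>0 - \<theta>star))" for e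
  define g where "g e j = \<gamma> * (1 - ?q e (Suc n - j)) / ((1 - a e) * N)" for e j

  \<comment> \<open>The mean of y x is \<open>\<Sigma> \<theta>star\<close>, so
    \<open>\<theta>star\<close> is a fixed point of the noiseless unregularized step. After
    centering at it, only the noise and the regularization pull towards \<open>\<theta>0\<close>
    remain as sources.\<close>
  have coordinate_step: "e \<bullet> (\<theta> (int k) \<omega> - \<theta>star) =
      a e * ((1 + \<delta>) * (e \<bullet> (\<theta> (int k - 1) \<omega> - \<theta>star)) - \<delta> * (e \<bullet> (\<theta> (int k - 2) \<omega> - \<theta>star)))
      + \<gamma> * (e \<bullet> \<xi> k \<omega>) + 1 / N\<^sup>2 * (e \<bullet> (\<theta>0 - \<theta>star))"
    if "e \<in> E" "\<omega> \<in> space M" "1 \<le> k" "k \<le> n" for e \<omega> k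
  proof -
    define z where "z = \<theta> (int k - 1) \<omega> + \<delta> *\<^sub>R (\<theta> (int k - 1) \<omega> - \<theta> (int k - 2) \<omega>)"
    have yx: "y k \<omega> * (e \<bullet> x k \<omega>) = e \<bullet> \<xi> k \<omega> + s e * (e \<bullet> \<theta>star)"
      using \<xi>_eq[OF \<open>1 \<le> k\<close>] by (simp add: inner_diff_right D.inner_operator that)
    have "e \<bullet> \<theta> (int k) \<omega> = (e \<bullet> z - \<gamma> * (s e * (e \<bullet> z)) - 1 / N\<^sup>2 * (e \<bullet> z))
        + \<gamma> * (y k \<omega> * (e \<bullet> x k \<omega>)) + 1 / N\<^sup>2 * (e \<bullet> \<theta>0)"
      unfolding \<theta>_rec[OF that(2-4) z_def]
      by (simp add: inner_diff_right inner_add_right D.inner_operator that(1) \<gamma>lam)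
    then show ?thesis
      unfolding yx by (simp add: z_def a_def inner_diff_right inner_add_right
          diff_divide_distrib algebra_simps)
  qed
  have coordinate: "e \<bullet> (\<theta>bar \<omega> - \<theta>star) = m e + (\<Sum>j=1..n. g e j * (e \<bullet> \<xi> j \<omega>))"
    if e: "e \<in> E" and \<omega>: "\<omega> \<in> space M" for e \<omega>
  proof -
    define u where "u k = e \<bullet> (\<theta> (int k) \<omega> - \<theta>star)" for k
    have u0: "u 0 = e \<bullet> (\<theta>0 - \<theta>star)"
      using \<omega> by (simp add: u_def \<theta>_0)
    \<comment> \<open>At the first step the momentum vanishes because \<open>\<theta> (-1)\<close>
      and \<open>\<theta> 0\<close> coincide.\<close>
    have first: "u 1 = a e * u 0 + \<gamma> * (e \<bullet> \<xi> 1 \<omega>) + 1 / N\<^sup>2 * u 0"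
      using coordinate_step[OF e \<omega>, of 1] n \<omega>
      by (simp add: u_def \<theta>_0 \<theta>_minus_1 algebra_simps)
    have rec: "u (Suc (Suc k)) = a e * ((1 + \<delta>) * u (Suc k) - \<delta> * u k)
        + \<gamma> * (e \<bullet> \<xi> (Suc (Suc k)) \<omega>) + 1 / N\<^sup>2 * u 0" if "Suc (Suc k) \<le> n" for k
      using coordinate_step[OF e \<omega>, of "Suc (Suc k)"] that
      unfolding u0 by (simp add: u_def)
    have "e \<bullet> (\<theta>bar \<omega> - \<theta>star) = (\<Sum>k\<le>n. u k) / N"
    proof -
      have "(\<Sum>i=0..int n. \<theta> i \<omega>) = (\<Sum>k\<le>n. \<theta> (int k) \<omega>)"
        by (rule sum.reindex_bij_witness[of _ int nat]) auto
      then have "e \<bullet> \<theta>bar \<omega> = (\<Sum>k\<le>n. e \<bullet> \<theta> (int k) \<omega>) / N"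
        using \<omega> by (simp add: \<theta>bar N_def inner_sum_right)
      moreover have "(\<Sum>k\<le>n. u k) = (\<Sum>k\<le>n. e \<bullet> \<theta> (int k) \<omega>) - N * (e \<bullet> \<theta>star)"
        by (simp add: u_def inner_diff_right sum_subtractf N_def)
      ultimately show ?thesis
        using N by (simp add: inner_diff_right diff_divide_distrib)
    qed
    also have "(\<Sum>k\<le>n. u k) = (N * p e + (1 - p e) * Q e) * u 0
        + (\<Sum>j=1..n. (1 - ?q e (Suc n - j)) * (\<gamma> * (e \<bullet> \<xi> j \<omega>))) / (1 - a e)"
      unfolding p_def Q_def N_def
      by (rule nesterov_sum) (use a[OF e] first rec in \<open>auto simp: N_def\<close>)
    also have "\<dots> / N = m e + (\<Sum>j=1..n. (1 - ?q e (Suc n - j)) * (\<gamma> * (e \<bullet> \<xi> j \<omega>))) / ((1 - a e) * N)"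
      using N unfolding m_def u0 by (simp add: add_divide_distrib distrib_right)
    also have "(\<Sum>j=1..n. (1 - ?q e (Suc n - j)) * (\<gamma> * (e \<bullet> \<xi> j \<omega>))) / ((1 - a e) * N)
        = (\<Sum>j=1..n. g e j * (e \<bullet> \<xi> j \<omega>))"
      unfolding sum_divide_distrib g_def by (intro sum.cong refl) simp
    finally show ?thesis .
  qed

  \<comment> \<open>Moments of the noise coordinates\<close>
  have Z_meas: "random_variable borel (\<lambda>\<omega>. e \<bullet> \<xi> j \<omega>)" if "1 \<le> j" for e j
    using \<xi>_meas[OF that] by measurable
  have Z_sq: "integrable M (\<lambda>\<omega>. (e \<bullet> \<xi> j \<omega>)\<^sup>2)" if "1 \<le> j" for e j
    using integrable_inner_square[OF \<xi>_meas[OF that] \<xi>_moment[OF that], of e]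
    by (simp add: inner_commute)
  have Z_int: "integrable M (\<lambda>\<omega>. e \<bullet> \<xi> j \<omega>)" if "1 \<le> j" for e j
    using \<xi>_int[OF that] by simp
  have Z_mean: "expectation (\<lambda>\<omega>. e \<bullet> \<xi> j \<omega>) = 0" if "1 \<le> j" for e j
  proof -
    have "expectation (\<xi> j) = 0"
      unfolding \<xi>_fun[OF that] using yx_int[OF that] mean[OF that] by (simp add: prob_space)
    then show ?thesis
      using \<xi>_int[OF that] by simp
  qed
  \<comment> \<open>Independence is given for the pairs, so each coordinate is written as one fixed
    continuous function of its pair.\<close>
  have Z_indep: "indep_vars (\<lambda>_. borel) (\<lambda>j \<omega>. e \<bullet> \<xi> j \<omega>) {1..}" for e
  proof -
    have "(\<lambda>p. e \<bullet> (snd p *\<^sub>R fst p - \<Sigma> \<theta>star)) \<in> borel_measurable (borel :: ('h \<times> real) measure)"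
      by (intro borel_measurable_continuous_onI continuous_intros)
    then have "indep_vars (\<lambda>_. borel)
        (\<lambda>j \<omega>. e \<bullet> (snd (x j \<omega>, y j \<omega>) *\<^sub>R fst (x j \<omega>, y j \<omega>) - \<Sigma> \<theta>star)) {1..}"
      by (intro indep_vars_compose2[OF indep])
    then show ?thesis
      by (subst indep_vars_cong[OF refl _ refl]) (auto simp: \<xi>_eq)
  qed
  have Z_uncorrelated: "expectation (\<lambda>\<omega>. (e \<bullet> \<xi> i \<omega>) * (e \<bullet> \<xi> j \<omega>)) = 0"
    if "1 \<le> i" "1 \<le> j" "i \<noteq> j" for e i j
    using expectation_mult_indep_vars[OF Z_indep, of i j e] that Z_int Z_mean by simp
  have Z_var: "expectation (\<lambda>\<omega>. (e \<bullet> \<xi> j \<omega>)\<^sup>2) \<le> \<tau>\<^sup>2 * s e" if "1 \<le> j" for e j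
  proof -
    have "0 \<le> e \<bullet> (\<tau>\<^sup>2 *\<^sub>R \<Sigma> e - second_moment M (\<xi> j) e)"
      using \<xi>_cov[OF that] unfolding loewner_le_def pos_semidef_def by blast
    then show ?thesis
      by (simp add: inner_diff_right s_def power2_eq_square inner_commute[of e "\<xi> _ _"]
          inner_second_moment[OF \<xi>_meas[OF that] \<xi>_moment[OF that]])
  qed
  note moments = expectation_square_uncorrelated
    [where J = "{1..n}" and Z = "\<lambda>j \<omega>. e \<bullet> \<xi> j \<omega>" and m = "m e" and g = "g e" for e,
      OF _ Z_meas Z_sq Z_mean Z_uncorrelated, simplified]

  \<comment> \<open>Excess risk as a sum over eigendirections\<close>
  have excess: "f v - f \<theta>star = 1/2 * (\<Sum>e\<in>E. s e * (e \<bullet> (v - \<theta>star))\<^sup>2)" for v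
  proof -
    have "f v - f \<theta>star = 1/2 * ((v - \<theta>star) \<bullet> \<Sigma> (v - \<theta>star))"
      unfolding f \<Sigma>
      by (intro ls_risk_excess x_meas y_meas x_moment y_moment)
        (use normal_equation in \<open>simp_all add: \<Sigma>\<close>)
    also have "(v - \<theta>star) \<bullet> \<Sigma> (v - \<theta>star) = (\<Sum>e\<in>E. s e * (e \<bullet> (v - \<theta>star))\<^sup>2)"
      unfolding D.inner_expand[of "v - \<theta>star"]
      by (intro sum.cong refl) (simp add: D.inner_operator power2_eq_square)
    finally show ?thesis .
  qed
  have risk: "(\<integral>\<omega>. f (\<theta>bar \<omega>) \<partial>M) - f \<theta>star
      = (\<Sum>e\<in>E. 1/2 * (s e * (m e)\<^sup>2)
          + 1/2 * (s e * (\<Sum>j=1..n. (g e j)\<^sup>2 * expectation (\<lambda>\<omega>. (e \<bullet> \<xi> j \<omega>)\<^sup>2))))"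
  proof -
    have "(\<integral>\<omega>. f (\<theta>bar \<omega>) \<partial>M) = (\<integral>\<omega>. f \<theta>star
        + (\<Sum>e\<in>E. 1/2 * s e * (m e + (\<Sum>j=1..n. g e j * (e \<bullet> \<xi> j \<omega>)))\<^sup>2) \<partial>M)"
    proof (rule Bochner_Integration.integral_cong[OF refl])
      fix \<omega> assume "\<omega> \<in> space M"
      then show "f (\<theta>bar \<omega>) = f \<theta>star
          + (\<Sum>e\<in>E. 1/2 * s e * (m e + (\<Sum>j=1..n. g e j * (e \<bullet> \<xi> j \<omega>)))\<^sup>2)"
        using excess[of "\<theta>bar \<omega>"] coordinate
        by (simp add: sum_distrib_left mult.assoc flip: sum_divide_distrib cong: sum.cong)
    qed
    also have "\<dots> = f \<theta>star + (\<Sum>e\<in>E. 1/2 * s e * ((m e)\<^sup>2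
        + (\<Sum>j=1..n. (g e j)\<^sup>2 * expectation (\<lambda>\<omega>. (e \<bullet> \<xi> j \<omega>)\<^sup>2))))"
      \<comment> \<open>\<open>moments\<close> also supplies the integrability of each square,
        without which the integral could not be distributed over the sum.\<close>
      using moments by (simp add: prob_space)
    finally show ?thesis
      by (simp add: distrib_left mult.assoc sum.distrib)
  qed

  \<comment> \<open>The 2 bounds \<bar>1 - q\<bar>, as \<bar>q\<bar> \<le> 1; the number of noises
    is n = N - 1.\<close>
  have noise_sum: "(\<Sum>j=1..n. (g e j)\<^sup>2 * expectation (\<lambda>\<omega>. (e \<bullet> \<xi> j \<omega>)\<^sup>2))
      \<le> (N - 1) * ((2 * \<gamma> / ((1 - a e) * N))\<^sup>2 * (\<tau>\<^sup>2 * s e))" if e: "e \<in> E" for e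
  proof -
    have g: "(g e j)\<^sup>2 \<le> (2 * \<gamma> / ((1 - a e) * N))\<^sup>2" for j
    proof -
      have "\<bar>1 - ?q e (Suc n - j)\<bar> \<le> 2"
        using abs_nesterov_factor_le_1[of "a e" \<delta> "Suc n - j"] a[OF e] \<delta>01 by simp
      then have "\<bar>g e j\<bar> \<le> 2 * \<gamma> / ((1 - a e) * N)"
        using a[OF e] N \<gamma> unfolding g_def by (simp add: abs_mult divide_right_mono)
      then have "\<bar>g e j\<bar>\<^sup>2 \<le> (2 * \<gamma> / ((1 - a e) * N))\<^sup>2"
        by (rule power_mono) simp
      then show ?thesis
        by simp
    qed
    have "(\<Sum>j=1..n. (g e j)\<^sup>2 * expectation (\<lambda>\<omega>. (e \<bullet> \<xi> j \<omega>)\<^sup>2))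
        \<le> (\<Sum>j=1..n. (2 * \<gamma> / ((1 - a e) * N))\<^sup>2 * (\<tau>\<^sup>2 * s e))"
      by (intro sum_mono mult_mono g Z_var) auto
    then show ?thesis
      by (simp add: N_def)
  qed

  \<comment> \<open>The bound for all exponents and its minimum\<close>
  define F where "F r = 74 * ((norm (op_powr \<Sigma> (r / 2) (\<theta>0 - \<theta>star)))\<^sup>2
      / (\<gamma> powr (1 - r) * (real n + 1) powr (2 * (1 - r))))" for r
  define G where "G b = 8 * (\<tau>\<^sup>2 * \<gamma> powr b * op_trace (op_powr \<Sigma> b)
      / (real n + 1) powr (1 - 2 * b))" for b
  have BFG: "B r b = F r + G b" for r b
    by (simp add: B F_def G_def)
  have bound: "(\<integral>\<omega>. f (\<theta>bar \<omega>) \<partial>M) - f \<theta>star \<le> B r b"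
    if "r \<in> {0..1}" "b \<in> {0..1}" for r b
  proof -
    have "(\<integral>\<omega>. f (\<theta>bar \<omega>) \<partial>M) - f \<theta>star
        \<le> (\<Sum>e\<in>E. 74 * ((s e powr (r / 2) * (e \<bullet> (\<theta>0 - \<theta>star)))\<^sup>2
              / (\<gamma> powr (1 - r) * N powr (2 * (1 - r))))
            + 8 * (\<tau>\<^sup>2 * \<gamma> powr b * s e powr b / N powr (1 - 2 * b)))"
      unfolding risk
    proof (intro sum_mono add_mono)
      fix e assume e: "e \<in> E"
      have "\<bar>Q e\<bar> \<le> 7 / sqrt (1 - a e)"
        unfolding Q_def using a[OF e] \<delta>01 damping[OF e] by (intro abs_sum_nesterov_factor_le)
      then show "1/2 * (s e * (m e)\<^sup>2) \<le> 74 * ((s e powr (r / 2) * (e \<bullet> (\<theta>0 - \<theta>star)))\<^sup>2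
          / (\<gamma> powr (1 - r) * N powr (2 * (1 - r))))"
        unfolding m_def using s_pos[OF e] \<gamma> N c that
        by (intro bias_term_bound[where c = "1 - a e"]) (auto simp: p_def)
      have "1/2 * (s e * (\<Sum>j=1..n. (g e j)\<^sup>2 * expectation (\<lambda>\<omega>. (e \<bullet> \<xi> j \<omega>)\<^sup>2)))
          \<le> 1/2 * (s e * ((N - 1) * ((2 * \<gamma> / ((1 - a e) * N))\<^sup>2 * (\<tau>\<^sup>2 * s e))))"
        using noise_sum[OF e] s_pos[OF e] by (intro mult_left_mono) auto
      also have "\<dots> \<le> 8 * (\<tau>\<^sup>2 * \<gamma> powr b * s e powr b / N powr (1 - 2 * b))"
        using s_pos[OF e] \<gamma> N c that by (intro variance_term_bound) auto
      finally show "1/2 * (s e * (\<Sum>j=1..n. (g e j)\<^sup>2 * expectation (\<lambda>\<omega>. (e \<bullet> \<xi> j \<omega>)\<^sup>2)))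
          \<le> 8 * (\<tau>\<^sup>2 * \<gamma> powr b * s e powr b / N powr (1 - 2 * b))" .
    qed
    also have "\<dots> = B r b"
      unfolding B D.norm_op_powr D.op_trace_op_powr N_def[symmetric]
      by (simp add: sum.distrib sum_distrib_left sum_divide_distrib)
    finally show ?thesis .
  qed
  \<comment> \<open>The spectral formulas turn norm and trace into finite sums of real powers whose
    bases are the positive eigenvalues, continuous in the exponent.\<close>
  have "continuous_on {0..1} F"
    unfolding F_def D.norm_op_powr
    using \<gamma> s_pos by (intro continuous_intros) (auto dest: s_pos)
  moreover have "continuous_on {0..1} G"
    unfolding G_def D.op_trace_op_powr
    using \<gamma> s_pos by (intro continuous_intros) (auto dest: s_pos)
  ultimately obtain r b where "r \<in> {0..1}" "b \<in> {0..1}"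
      "\<And>r' b'. r' \<in> {0..1} \<Longrightarrow> b' \<in> {0..1} \<Longrightarrow> F r + G b \<le> F r' + G b'"
    by (rule continuous_minimum_separable) blast
  then show ?thesis
    using bound unfolding BFG by blast
qed

end
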